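(* Let $\mathcal{W}\subseteq\mathbb{C}^n$ be an irreducible algebraic variety, let $\mathcal{V}=\mathcal{W}\cup\overline{\mathcal{W}}$, and let $\mathcal{R}=\mathbb{R}[\mathcal{V}]$. Let $\mathcal{L}_{2d}\subseteq\mathcal{R}$ be a finite-dimensional real linear subspace and let $D:=\dim(\mathcal{L}_{2d})$. Let $S$ be an integer with $S\geq D/2$. Then, for tuples of samples $Z=(z_1,\ldots,z_S)$ in $\mathcal{W}$, the property that $(\mathcal{L}_{2d},Z)$ is poised holds c-generically. That is, there is a polynomial $q$ with complex coefficients in $2Sn$ variables such that $q(z_1,\ldots,z_S,\overline{z_1},\ldots,\overline{z_S})$ is not identically zero for $z_1,\ldots,z_S\in\mathcal{W}$, and such that $(\mathcal{L}_{2d},Z)$ is poised for every $Z=(z_1,\ldots,z_S)\in\mathcal{W}^S$ with $q(z_1,\ldots,z_S,\overline{z_1},\ldots,\overline{z_S})\neq 0$.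
   Context: An algebraic variety in $\mathbb{C}^n$ is the common zero set of a set of polynomials with complex coefficients; it is irreducible if it is not the union of two proper subvarieties. For $\mathcal{W}\subseteq\mathbb{C}^n$, $\overline{\mathcal{W}}$ denotes the set of (coordinatewise) complex conjugates of points of $\mathcal{W}$. The variety $\mathcal{V}=\mathcal{W}\cup\overline{\mathcal{W}}$ is self-conjugate, i.e. $\overline{\mathcal{V}}=\mathcal{V}$. The (real) coordinate ring is $\mathbb{R}[\mathcal{V}]:=\mathbb{R}[x_1,\ldots,x_n]/\{f\in\mathbb{R}[x_1,\ldots,x_n]: f(z)=0\text{ for all }z\in\mathcal{V}\}$; its elements are identified with the (complex-valued) functions they define on $\mathcal{V}$. The subscript in $\mathcal{L}_{2d}$ is only notation. Poisedness: for a linear subspace $\mathcal{L}\subseteq\mathbb{R}[\mathcal{V}]$ and a set of samples $Z\subseteq\mathcal{V}$, the pair $(\mathcal{L},Z)$ is poised if the only $q\in\mathcal{L}$ with $q(z)=0$ for all $z\in Z$ is $q=0$ in $\mathbb{R}[\mathcal{V}]$. For a tuple $Z$, this refers to the set of its entries. *)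

theory Defs
  imports
    "HOL-Analysis.Analysis"
    "HOL-Library.Poly_Mapping"
    "HOL-Library.Function_Algebras"
begin

section \<open>Multivariate polynomials\<close>

text \<open>A monomial maps each variable to its exponent, a polynomial maps each monomial to
  its coefficient.\<close>

type_synonym ('v, 'a) mpoly = "('v \<Rightarrow>\<^sub>0 nat) \<Rightarrow>\<^sub>0 'a"

definition vars :: "('v, 'a::zero) mpoly \<Rightarrow> 'v set" where
  "vars p = (\<Union>m\<in>Poly_Mapping.keys p. Poly_Mapping.keys m)"

definition insertion :: "('v \<Rightarrow> 'a::comm_semiring_1) \<Rightarrow> ('v, 'a) mpoly \<Rightarrow> 'a" where
  "insertion x p = (\<Sum>m\<in>Poly_Mapping.keys p.
     Poly_Mapping.lookup p m * (\<Prod>i\<in>Poly_Mapping.keys m. x i ^ Poly_Mapping.lookup m i))"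

definition complexify :: "('v, real) mpoly \<Rightarrow> ('v, complex) mpoly" where
  "complexify p = Poly_Mapping.map complex_of_real p"

section \<open>Varieties\<close>

definition algebraic_variety :: "(complex ^ 'n) set \<Rightarrow> bool" where
  "algebraic_variety V \<longleftrightarrow>
     (\<exists>P :: ('n, complex) mpoly set. V = {z. \<forall>p\<in>P. insertion (($) z) p = 0})"

text \<open>As usual, an irreducible variety is required to be nonempty.\<close>

definition irreducible_variety :: "(complex ^ 'n) set \<Rightarrow> bool" where
  "irreducible_variety W \<longleftrightarrow> algebraic_variety W \<and> W \<noteq> {} \<and>
     (\<nexists>A B. algebraic_variety A \<and> algebraic_variety B \<and> A \<subset> W \<and> B \<subset> W \<and> W = A \<union> B)"

definition vec_cnj :: "complex ^ 'n \<Rightarrow> complex ^ 'n" where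
  "vec_cnj z = (\<chi> i. cnj (z $ i))"

section \<open>The real coordinate ring\<close>

text \<open>Functions into a real vector space form a real vector space under the pointwise
  operations; this makes \<open>subspace\<close>, \<open>span\<close> and \<open>dim\<close> available for sets of functions.\<close>

instantiation "fun" :: (type, real_vector) real_vector
begin

definition scaleR_fun :: "real \<Rightarrow> ('a \<Rightarrow> 'b) \<Rightarrow> 'a \<Rightarrow> 'b" where
  "scaleR_fun r f = (\<lambda>x. r *\<^sub>R f x)"

instance
  by standard (auto simp: scaleR_fun_def fun_eq_iff algebra_simps)

end

definition vanishing_ideal :: "(complex ^ 'n) set \<Rightarrow> ('n, real) mpoly set" where
  "vanishing_ideal V = {f. \<forall>z\<in>V. insertion (($) z) (complexify f) = 0}"

text \<open>The class of a real polynomial modulo the vanishing ideal of \<open>V\<close> is represented by the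
  complex-valued function that it defines on \<open>V\<close>, extended by 0 outside \<open>V\<close> so that
  equality and the vector space operations of the function type are those of functions
  on \<open>V\<close>. Lemma \<open>coord_fun_eq_iff\<close> below shows that this is the quotient by the ideal.\<close>

definition coord_fun ::
  "(complex ^ 'n) set \<Rightarrow> ('n, real) mpoly \<Rightarrow> complex ^ 'n \<Rightarrow> complex" where
  "coord_fun V f = (\<lambda>z. if z \<in> V then insertion (($) z) (complexify f) else 0)"

definition real_coord_ring :: "(complex ^ 'n) set \<Rightarrow> (complex ^ 'n \<Rightarrow> complex) set" where
  "real_coord_ring V = range (coord_fun V)"

lemma insertion_superset:
  assumes "finite K" "Poly_Mapping.keys p \<subseteq> K"
  shows "insertion x p = (\<Sum>m\<in>K.
    Poly_Mapping.lookup p m * (\<Prod>i\<in>Poly_Mapping.keys m. x i ^ Poly_Mapping.lookup m i))"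
  unfolding insertion_def using assms
  by (intro sum.mono_neutral_left) (auto simp: in_keys_iff)

lemma lookup_complexify: "Poly_Mapping.lookup (complexify p) m = complex_of_real (Poly_Mapping.lookup p m)"
  by (simp add: complexify_def map.rep_eq when_def)

lemma insertion_complexify:
  "insertion x (complexify p) =
     (\<Sum>m\<in>Poly_Mapping.keys p.
        of_real (Poly_Mapping.lookup p m) * (\<Prod>i\<in>Poly_Mapping.keys m. x i ^ Poly_Mapping.lookup m i))"
  by (subst insertion_superset[of "Poly_Mapping.keys p"]) (auto simp: lookup_complexify in_keys_iff)

lemma insertion_add: "insertion x (p + q) = insertion x p + insertion x q"
proof -
  let ?K = "Poly_Mapping.keys p \<union> Poly_Mapping.keys q"
  have "Poly_Mapping.keys (p + q) \<subseteq> ?K"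
    by (rule Poly_Mapping.keys_add)
  then show ?thesis
    by (simp add: insertion_superset[of ?K] lookup_add distrib_right sum.distrib)
qed

lemma complexify_add: "complexify (p + q) = complexify p + complexify q"
  by (rule poly_mapping_eqI) (simp add: lookup_complexify lookup_add)

lemma coord_fun_add: "coord_fun V (f + g) = coord_fun V f + coord_fun V g"
  by (auto simp: coord_fun_def fun_eq_iff complexify_add insertion_add)

lemma coord_fun_scale:
  "coord_fun V (Poly_Mapping.map ((*) r) f) = r *\<^sub>R coord_fun V f"
proof -
  have "insertion x (complexify (Poly_Mapping.map ((*) r) f)) =
      of_real r * insertion x (complexify f)"
    for x :: "'a \<Rightarrow> complex"
  proof -
    have k: "Poly_Mapping.keys (complexify (Poly_Mapping.map ((*) r) f)) \<subseteq> Poly_Mapping.keys f"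
      "Poly_Mapping.keys (complexify f) \<subseteq> Poly_Mapping.keys f"
      by (auto simp: in_keys_iff lookup_complexify map.rep_eq when_def)
    show ?thesis
      by (simp add: insertion_superset[OF _ k(1)] insertion_superset[OF _ k(2)] lookup_complexify
          map.rep_eq when_def sum_distrib_left mult.assoc, intro sum.cong)
        (auto simp: in_keys_iff)
  qed
  then show ?thesis
    by (auto simp: coord_fun_def fun_eq_iff scaleR_fun_def scaleR_conv_of_real)
qed

lemma coord_fun_eq_iff: "coord_fun V f = coord_fun V g \<longleftrightarrow> f - g \<in> vanishing_ideal V"
proof -
  have "insertion x (complexify f) = insertion x (complexify (f - g)) + insertion x (complexify g)"
    for x :: "'a \<Rightarrow> complex"
    by (simp flip: insertion_add complexify_add)
  then show ?thesis
    by (auto simp: coord_fun_def fun_eq_iff vanishing_ideal_def)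
qed

lemma subspace_real_coord_ring: "subspace (real_coord_ring V)"
proof (rule subspaceI)
  show "0 \<in> real_coord_ring V"
    using coord_fun_scale[of V 0 0] by (metis real_coord_ring_def rangeI scaleR_zero_left)
qed (auto simp: real_coord_ring_def simp flip: coord_fun_add coord_fun_scale)

section \<open>Poisedness and genericity\<close>

text \<open>Elements of the coordinate ring of \<open>V\<close> are 0 outside \<open>V\<close>, so that \<open>q = 0\<close> is
  equality in that ring.\<close>

definition poised :: "(complex ^ 'n \<Rightarrow> complex) set \<Rightarrow> (complex ^ 'n) set \<Rightarrow> bool" where
  "poised L Z \<longleftrightarrow> (\<forall>q\<in>L. (\<forall>z\<in>Z. q z = 0) \<longrightarrow> q = 0)"

definition tuples :: "nat \<Rightarrow> 'a set \<Rightarrow> 'a list set" where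
  "tuples S W = {Z. length Z = S \<and> set Z \<subseteq> W}"

text \<open>The variable \<open>Inl (k, j)\<close> stands for the \<open>j\<close>-th coordinate of the \<open>k\<close>-th sample, and
  \<open>Inr (k, j)\<close> for its conjugate; samples are numbered from 0.\<close>

definition sample_coords ::
  "(complex ^ 'n) list \<Rightarrow> (nat \<times> 'n) + (nat \<times> 'n) \<Rightarrow> complex" where
  "sample_coords Z = case_sum (\<lambda>(k, j). (Z ! k) $ j) (\<lambda>(k, j). vec_cnj (Z ! k) $ j)"

definition c_generically ::
  "(complex ^ 'n) set \<Rightarrow> nat \<Rightarrow> ((complex ^ 'n) list \<Rightarrow> bool) \<Rightarrow> bool" where
  "c_generically W S P \<longleftrightarrow>
     (\<exists>q :: ((nat \<times> 'n) + (nat \<times> 'n), complex) mpoly.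
        vars q \<subseteq> ({..<S} \<times> UNIV) <+> ({..<S} \<times> UNIV) \<and>
        (\<exists>Z\<in>tuples S W. insertion (sample_coords Z) q \<noteq> 0) \<and>
        (\<forall>Z\<in>tuples S W. insertion (sample_coords Z) q \<noteq> 0 \<longrightarrow> P Z))"

end

theory Submission
  imports
    Defs
    "HOL-Computational_Algebra.Fundamental_Theorem_Algebra"
    "Jordan_Normal_Form.Determinant"
begin

text \<open>Poisedness of a tuple \<open>Z\<close> is the nonvanishing of the Gram determinant of a basis of \<open>L\<close>
  with respect to the real inner product \<open>\<Sum>\<^sub>k Re (f (z\<^sub>k) cnj (g (z\<^sub>k)))\<close>, which is a polynomial in
  the samples and their conjugates. So it suffices to find one poised tuple. Sample points are
  chosen greedily, each of them cutting the dimension of \<open>L\<close> by 2: this fails only if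
  \<open>f cnj g\<close> is real on \<open>W\<close> for some linearly independent \<open>f, g \<in> L\<close>. Then \<open>f / g\<close> omits all
  nonreal values, so all \<open>1 / (f / g - c)\<close> with \<open>c\<close> nonreal are regular functions on the open set
  \<open>g \<noteq> 0\<close> of \<open>W\<close>. As their ring has countable dimension over the complex numbers, these
  functions are linearly dependent, so \<open>f / g\<close> is algebraic over the complex numbers, hence constant.
  The same countability argument gives the Nullstellensatz that was used for regularity.\<close>

hide_const (open) Module.smult
no_notation vec_index (infixl "$" 100)

section \<open>Polynomial functions\<close>

definition mon_eval :: "('v \<Rightarrow> 'a::comm_semiring_1) \<Rightarrow> ('v \<Rightarrow>\<^sub>0 nat) \<Rightarrow> 'a" where
  "mon_eval x m = (\<Prod>i\<in>Poly_Mapping.keys m. x i ^ Poly_Mapping.lookup m i)"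

definition Const :: "'a::zero \<Rightarrow> ('v, 'a) mpoly" where
  "Const c = Poly_Mapping.single 0 c"

definition Var :: "'v \<Rightarrow> ('v, 'a::zero_neq_one) mpoly" where
  "Var i = Poly_Mapping.single (Poly_Mapping.single i 1) 1"

lemma mon_eval_add: "mon_eval x (a + b) = mon_eval x a * mon_eval x b"
proof -
  let ?K = "Poly_Mapping.keys a \<union> Poly_Mapping.keys b"
  have eq: "mon_eval x m = (\<Prod>i\<in>?K. x i ^ Poly_Mapping.lookup m i)"
    if "Poly_Mapping.keys m \<subseteq> ?K" for m
    unfolding mon_eval_def using that
    by (intro prod.mono_neutral_left) (auto simp: in_keys_iff)
  show ?thesis
    by (simp add: eq keys_add lookup_add power_add prod.distrib)
qed

text \<open>Values in a \<open>monoid_add\<close> make the rule applicable to polynomials and also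
  to monomials, which are finitely supported maps into the naturals.\<close>

lemma poly_mapping_single_add_induct:
  fixes p :: "'a \<Rightarrow>\<^sub>0 'b::monoid_add"
  assumes "\<And>m c. P (Poly_Mapping.single m c)" "\<And>p q. P p \<Longrightarrow> P q \<Longrightarrow> P (p + q)"
  shows "P p"
proof (induction p rule: update_induct)
  case const
  \<comment> \<open>The zero map is a \<open>single\<close> with value 0 at an arbitrary
    key.\<close>
  show ?case using assms(1)[of undefined 0] by simp
next
  case (update f a b)
  have "Poly_Mapping.update a b f = f + Poly_Mapping.single a b"
    using update(1) by (intro poly_mapping_eqI)
      (auto simp: lookup_update lookup_add lookup_single when_def in_keys_iff)
  then show ?case using assms update by simp
qed

lemma insertion_eq_mon_eval:
  "insertion x p = (\<Sum>m\<in>Poly_Mapping.keys p. Poly_Mapping.lookup p m * mon_eval x m)"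
  by (simp add: insertion_def mon_eval_def)

lemma insertion_single: "insertion x (Poly_Mapping.single m c) = c * mon_eval x m"
  by (simp add: insertion_eq_mon_eval)

lemma insertion_mult: "insertion x (p * q) = insertion x p * insertion x q"
proof (induction p rule: poly_mapping_single_add_induct)
  case (1 m c)
  show ?case
    by (induction q rule: poly_mapping_single_add_induct)
      (simp_all add: mult_single insertion_single mon_eval_add insertion_add distrib_left mult.assoc mult.left_commute)
qed (simp add: distrib_right insertion_add)

lemma insertion_Const [simp]: "insertion x (Const c) = c"
  by (simp add: Const_def insertion_single mon_eval_def)

lemma insertion_Var [simp]: "insertion x (Var i) = x i"
  by (simp add: Var_def insertion_single mon_eval_def)

lemma Const_0 [simp]: "Const 0 = 0"
  by (simp add: Const_def)

lemma Const_1 [simp]: "Const 1 = 1"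
  by (simp add: Const_def)

lemma Const_add: "Const (a + b) = Const a + Const b"
  by (simp add: Const_def single_add)

lemma Const_diff:
  fixes a b :: "'a::ab_group_add"
  shows "Const (a - b) = Const a - Const b"
  by (simp add: Const_def single_diff)

lemma Const_mult: "Const (a * b) = Const a * Const b"
  by (simp add: Const_def mult_single)

lemma insertion_diff: "insertion x (p - q) = insertion x p - insertion x q"
  for p q :: "('v, 'a::comm_ring_1) mpoly"
  using insertion_add[of x "p - q" q] by simp

lemma insertion_1 [simp]: "insertion x 1 = 1"
  using insertion_Const[of x 1] by simp

text \<open>A monomial is a product of powers of variables, so it is reached from \<open>Var\<close>
  and \<open>mult\<close> by inner inductions on the monomial and on an exponent.\<close>

lemma mpoly_induct [case_names Const Var add mult]:
  fixes p :: "('v, 'a::comm_semiring_1) mpoly"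
  assumes Const: "\<And>c. P (Const c)" and Var: "\<And>i. P (Var i)"
    and add: "\<And>p q. P p \<Longrightarrow> P q \<Longrightarrow> P (p + q)" and mult: "\<And>p q. P p \<Longrightarrow> P q \<Longrightarrow> P (p * q)"
  shows "P p"
proof (induction p rule: poly_mapping_single_add_induct)
  case (1 m c)
  have "P (Poly_Mapping.single m 1)"
  proof (induction m rule: poly_mapping_single_add_induct)
    case (1 i k)
    show ?case
    proof (induction k)
      case 0
      show ?case using Const[of 1] by (simp add: Const_def)
    next
      case (Suc k)
      have "Poly_Mapping.single (Poly_Mapping.single i (Suc k)) 1 =
          Var i * Poly_Mapping.single (Poly_Mapping.single i k) (1::'a)"
        by (simp add: Var_def mult_single flip: single_add)
      then show ?case using Suc Var mult by simp
    qed
  next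
    case (2 a b)
    then show ?case using mult by (fastforce simp: mult_single)
  qed
  then have "P (Const c * Poly_Mapping.single m 1)" by (intro mult Const)
  then show ?case by (simp add: Const_def mult_single)
qed (rule add)

section \<open>Functions that are polynomial in prescribed variables\<close>

text \<open>The bound on the variables is tracked because \<open>c_generically\<close> restricts the
  variables of its witness. Closure properties of functions then yield that witness without writing
  down a polynomial.\<close>

definition polyfun :: "'v set \<Rightarrow> (('v \<Rightarrow> 'a) \<Rightarrow> 'a::comm_ring_1) \<Rightarrow> bool" where
  "polyfun X g \<longleftrightarrow> (\<exists>p. vars p \<subseteq> X \<and> (\<forall>x. insertion x p = g x))"

lemma vars_add: "vars (p + q) \<subseteq> vars p \<union> vars q"
  for p q :: "('v, 'a::monoid_add) mpoly"
  using Poly_Mapping.keys_add[of p q] by (auto simp: vars_def)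

lemma vars_mult: "vars (p * q) \<subseteq> vars p \<union> vars q"
  for p q :: "('v, 'a::comm_semiring_1) mpoly"
proof
  fix i assume "i \<in> vars (p * q)"
  then obtain m where m: "m \<in> Poly_Mapping.keys (p * q)" "i \<in> Poly_Mapping.keys m"
    by (auto simp: vars_def)
  with keys_mult[of p q] obtain a b where
    ab: "m = a + b" "a \<in> Poly_Mapping.keys p" "b \<in> Poly_Mapping.keys q" by blast
  from m ab have "i \<in> Poly_Mapping.keys a \<union> Poly_Mapping.keys b"
    using Poly_Mapping.keys_add[of a b] by auto
  with ab show "i \<in> vars p \<union> vars q" by (auto simp: vars_def)
qed

lemma polyfun_const: "polyfun X (\<lambda>_. c)"
  unfolding polyfun_def by (rule exI[of _ "Const c"]) (simp, simp add: vars_def Const_def)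

lemma polyfun_var: "i \<in> X \<Longrightarrow> polyfun X (\<lambda>x. x i)"
  unfolding polyfun_def by (rule exI[of _ "Var i"]) (simp, simp add: vars_def Var_def)

lemma polyfun_add:
  assumes "polyfun X f" "polyfun X g"
  shows "polyfun X (\<lambda>x. f x + g x)"
proof -
  from assms obtain p q where "vars p \<subseteq> X" "\<forall>x. insertion x p = f x"
    "vars q \<subseteq> X" "\<forall>x. insertion x q = g x" by (auto simp: polyfun_def)
  then show ?thesis unfolding polyfun_def
    using vars_add[of p q] by (intro exI[of _ "p + q"]) (auto simp: insertion_add)
qed

lemma polyfun_mult:
  assumes "polyfun X f" "polyfun X g"
  shows "polyfun X (\<lambda>x. f x * g x)"
proof -
  from assms obtain p q where "vars p \<subseteq> X" "\<forall>x. insertion x p = f x"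
    "vars q \<subseteq> X" "\<forall>x. insertion x q = g x" by (auto simp: polyfun_def)
  then show ?thesis unfolding polyfun_def
    using vars_mult[of p q] by (intro exI[of _ "p * q"]) (auto simp: insertion_mult)
qed

lemma polyfun_sum: "(\<And>i. i \<in> I \<Longrightarrow> polyfun X (f i)) \<Longrightarrow> polyfun X (\<lambda>x. \<Sum>i\<in>I. f i x)"
  by (induction I rule: infinite_finite_induct) (auto intro: polyfun_const polyfun_add)

lemma polyfun_prod: "(\<And>i. i \<in> I \<Longrightarrow> polyfun X (f i)) \<Longrightarrow> polyfun X (\<lambda>x. \<Prod>i\<in>I. f i x)"
  by (induction I rule: infinite_finite_induct) (auto intro: polyfun_const polyfun_mult)

lemma polyfun_power: "polyfun X f \<Longrightarrow> polyfun X (\<lambda>x. f x ^ n)"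
  by (induction n) (auto intro: polyfun_const polyfun_mult)

text \<open>The renaming \<open>\<phi>\<close> turns a polynomial in the coordinates of a point into
  one in the coordinates of a chosen sample, or in their conjugates.\<close>

lemma polyfun_insertion:
  assumes "\<And>i. i \<in> vars p \<Longrightarrow> \<phi> i \<in> X"
  shows "polyfun X (\<lambda>x. insertion (\<lambda>i. x (\<phi> i)) p)"
  unfolding insertion_def
  by (intro polyfun_sum polyfun_mult polyfun_prod polyfun_power polyfun_const polyfun_var assms)
    (auto simp: vars_def)

section \<open>Ideals\<close>

definition is_ideal :: "'a::comm_ring_1 set \<Rightarrow> bool" where
  "is_ideal I \<longleftrightarrow> 0 \<in> I \<and> (\<forall>a\<in>I. \<forall>b\<in>I. a + b \<in> I) \<and> (\<forall>a\<in>I. \<forall>r. r * a \<in> I)"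

definition is_prime_ideal :: "'a::comm_ring_1 set \<Rightarrow> bool" where
  "is_prime_ideal I \<longleftrightarrow> is_ideal I \<and> 1 \<notin> I \<and> (\<forall>a b. a * b \<in> I \<longrightarrow> a \<in> I \<or> b \<in> I)"

lemma prime_ideal_is_ideal: "is_prime_ideal I \<Longrightarrow> is_ideal I"
  by (simp add: is_prime_ideal_def)

lemma prime_idealD: "is_prime_ideal I \<Longrightarrow> a * b \<in> I \<Longrightarrow> a \<in> I \<or> b \<in> I"
  by (simp add: is_prime_ideal_def)

lemma ideal_zero: "is_ideal I \<Longrightarrow> 0 \<in> I"
  by (simp add: is_ideal_def)

lemma ideal_add: "is_ideal I \<Longrightarrow> a \<in> I \<Longrightarrow> b \<in> I \<Longrightarrow> a + b \<in> I"
  by (simp add: is_ideal_def)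

lemma ideal_mult: "is_ideal I \<Longrightarrow> a \<in> I \<Longrightarrow> r * a \<in> I"
  by (simp add: is_ideal_def)

lemma ideal_diff: "is_ideal I \<Longrightarrow> a \<in> I \<Longrightarrow> b \<in> I \<Longrightarrow> a - b \<in> I"
  using ideal_add[of I a "- 1 * b"] ideal_mult[of I b "-1"] by simp

lemma ideal_sum: "is_ideal I \<Longrightarrow> (\<And>i. i \<in> A \<Longrightarrow> f i \<in> I) \<Longrightarrow> sum f A \<in> I"
  by (induction A rule: infinite_finite_induct) (auto intro: ideal_zero ideal_add)

lemma ideal_iff_of_diff: "is_ideal I \<Longrightarrow> a - b \<in> I \<Longrightarrow> a \<in> I \<longleftrightarrow> b \<in> I"
  using ideal_add[of I "a - b" b] ideal_diff[of I a "a - b"] by auto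

lemma prime_ideal_power: "is_prime_ideal I \<Longrightarrow> a ^ n \<in> I \<Longrightarrow> a \<in> I"
  by (induction n) (auto simp: is_prime_ideal_def)

lemma is_ideal_adjoin:
  assumes I: "is_ideal I"
  shows "is_ideal {m + r * a | m r. m \<in> I}"
  unfolding is_ideal_def
proof (intro conjI ballI allI)
  show "0 \<in> {m + r * a | m r. m \<in> I}"
    using ideal_zero[OF I] by (intro CollectI exI[of _ 0]) auto
next
  fix x y assume "x \<in> {m + r * a | m r. m \<in> I}" "y \<in> {m + r * a | m r. m \<in> I}"
  then obtain m r m' r' where *: "x = m + r * a" "y = m' + r' * a" "m \<in> I" "m' \<in> I" by blast
  have "x + y = (m + m') + (r + r') * a" using * by (simp add: algebra_simps)
  then show "x + y \<in> {m + r * a | m r. m \<in> I}" using ideal_add[OF I *(3,4)] by blast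
next
  fix x s assume "x \<in> {m + r * a | m r. m \<in> I}"
  then obtain m r where *: "x = m + r * a" "m \<in> I" by blast
  have "s * x = s * m + (s * r) * a" using * by (simp add: algebra_simps)
  then show "s * x \<in> {m + r * a | m r. m \<in> I}" using ideal_mult[OF I *(2)] by blast
qed

text \<open>Zorn's lemma gives an ideal maximal among those that contain \<open>I\<close> but no
  power of \<open>f\<close>. It corresponds to a maximal ideal of the localization at
  \<open>f\<close>, so every \<open>a\<close> outside it is invertible modulo it once
  \<open>f\<close> is inverted; the last conclusion expresses this without fractions.\<close>

lemma exists_maximal_ideal_avoiding_powers:
  fixes f :: "'a::comm_ring_1"
  assumes I: "is_ideal I" and f: "\<And>n. f ^ n \<notin> I"
  obtains M where "I \<subseteq> M" "is_prime_ideal M" "f \<notin> M"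
    and "\<And>a. a \<notin> M \<Longrightarrow> \<exists>n r. a * r - f ^ n \<in> M"
proof -
  define F where "F = {J. is_ideal J \<and> I \<subseteq> J \<and> (\<forall>n. f ^ n \<notin> J)}"
  have "\<exists>M\<in>F. \<forall>X\<in>F. M \<subseteq> X \<longrightarrow> X = M"
  proof (rule subset_Zorn_nonempty)
    show "F \<noteq> {}" using assms by (auto simp: F_def)
  next
    fix C assume C: "C \<noteq> {}" "subset.chain F C"
    then have CF: "C \<subseteq> F" and lin: "\<And>A B. A \<in> C \<Longrightarrow> B \<in> C \<Longrightarrow> A \<subseteq> B \<or> B \<subseteq> A"
      by (auto simp: subset.chain_def subset_chain_def)
    have "is_ideal (\<Union>C)"
      unfolding is_ideal_def
    proof (intro conjI ballI allI)
      show "0 \<in> \<Union>C" using C(1) CF ideal_zero by (force simp: F_def)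
    next
      fix a b assume "a \<in> \<Union>C" "b \<in> \<Union>C"
      then obtain A B where "A \<in> C" "a \<in> A" "B \<in> C" "b \<in> B" by blast
      with lin[of A B] obtain D where "D \<in> C" "a \<in> D" "b \<in> D" by blast
      with CF have "a + b \<in> D" by (auto simp: F_def intro: ideal_add)
      with \<open>D \<in> C\<close> show "a + b \<in> \<Union>C" by blast
    next
      fix a r assume "a \<in> \<Union>C"
      then show "r * a \<in> \<Union>C" using CF by (auto simp: F_def intro: ideal_mult)
    qed
    then show "\<Union>C \<in> F" using C(1) CF by (auto simp: F_def)
  qed
  then obtain M where M: "is_ideal M" "I \<subseteq> M" "\<And>n. f ^ n \<notin> M"
    and max: "\<And>X. X \<in> F \<Longrightarrow> M \<subseteq> X \<Longrightarrow> X = M"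
    by (auto simp: F_def)
  have ex: "\<exists>n r. a * r - f ^ n \<in> M" if "a \<notin> M" for a
  proof -
    let ?J = "{m + r * a | m r. m \<in> M}"
    have sub: "M \<subseteq> ?J" by (force intro: exI[of _ 0])
    have "a \<in> ?J" using ideal_zero[OF M(1)] by (force intro: exI[of _ 1])
    then have "?J \<noteq> M" using that by blast
    then have "?J \<notin> F" using max sub by blast
    then obtain n where "f ^ n \<in> ?J"
      using is_ideal_adjoin[OF M(1)] M(2) sub by (auto simp: F_def)
    then obtain m r where mr: "f ^ n = m + r * a" "m \<in> M" by blast
    have "a * r - f ^ n = - 1 * m" using mr by (simp add: algebra_simps)
    then show ?thesis using ideal_mult[OF M(1) mr(2)] by metis
  qed
  have "a \<in> M \<or> b \<in> M" if ab: "a * b \<in> M" for a b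
  proof (rule ccontr)
    assume "\<not> (a \<in> M \<or> b \<in> M)"
    then obtain n r k s where nr: "a * r - f ^ n \<in> M" and ks: "b * s - f ^ k \<in> M"
      using ex by meson
    \<comment> \<open>Modulo \<open>M\<close>, \<open>a * r\<close> is \<open>f ^ n\<close> and
      \<open>b * s\<close> is \<open>f ^ k\<close>, so \<open>f ^ (n + k)\<close> is a multiple of
      \<open>a * b\<close>.\<close>
    have "f ^ (n + k) = (r * s) * (a * b) - (b * s) * (a * r - f ^ n) - f ^ n * (b * s - f ^ k)"
      by (simp add: algebra_simps power_add)
    also have "\<dots> \<in> M"
      by (intro ideal_diff ideal_mult[OF M(1) ab] ideal_mult[OF M(1) nr] ideal_mult[OF M(1) ks] M(1))
    finally show False using M(3) by blast
  qed
  moreover have "1 \<notin> M" "f \<notin> M" using M(3)[of 0] M(3)[of 1] by auto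
  ultimately show ?thesis using that M(1,2) ex by (auto simp: is_prime_ideal_def)
qed

section \<open>Lines in prime ideals\<close>

interpretation mpoly: vector_space "\<lambda>c (p :: ('v, 'a::field) mpoly). Const c * p"
  by standard (simp_all add: Const_add Const_mult algebra_simps)

text \<open>Bounding each exponent separately embeds these monomials into a finite function space
  when there are finitely many variables. Countable dimension of the ring is used as exhaustion by
  their spans.\<close>

definition monomials_upto :: "nat \<Rightarrow> ('v, 'a::zero_neq_one) mpoly set" where
  "monomials_upto N = (\<lambda>m. Poly_Mapping.single m 1) ` {m. \<forall>i. Poly_Mapping.lookup m i \<le> N}"

lemma finite_monomials_upto: "finite (monomials_upto N :: ('v::finite, 'a::zero_neq_one) mpoly set)"
proof -
  have "Poly_Mapping.lookup ` {m :: 'v \<Rightarrow>\<^sub>0 nat. \<forall>i. Poly_Mapping.lookup m i \<le> N} \<subseteq> (UNIV \<rightarrow>\<^sub>E {..N})"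
    by auto
  moreover have "finite ((UNIV :: 'v set) \<rightarrow>\<^sub>E {..N})"
    by (rule finite_PiE) auto
  ultimately have "finite {m :: 'v \<Rightarrow>\<^sub>0 nat. \<forall>i. Poly_Mapping.lookup m i \<le> N}"
    by (meson finite_subset finite_imageD lookup_inject inj_onI)
  then show ?thesis by (simp add: monomials_upto_def)
qed

lemma monomials_upto_mono: "M \<le> N \<Longrightarrow> monomials_upto M \<subseteq> monomials_upto N"
  unfolding monomials_upto_def by (rule image_mono) (auto intro: le_trans)

lemma mpoly_in_span_monomials_upto:
  fixes p :: "('v::finite, 'a::field) mpoly"
  shows "\<exists>N. p \<in> mpoly.span (monomials_upto N)"
proof (induction p rule: poly_mapping_single_add_induct)
  case (1 m c)
  have "Poly_Mapping.lookup m i \<le> sum (Poly_Mapping.lookup m) UNIV" for i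
    by (rule member_le_sum) auto
  then have "Poly_Mapping.single m 1 \<in> mpoly.span (monomials_upto (sum (Poly_Mapping.lookup m) UNIV))"
    by (intro mpoly.span_base) (auto simp: monomials_upto_def)
  from mpoly.span_scale[OF this, of c] show ?case
    by (auto simp: Const_def mult_single)
next
  case (2 p q)
  then obtain M N where "p \<in> mpoly.span (monomials_upto M)" "q \<in> mpoly.span (monomials_upto N)" by blast
  then have "p \<in> mpoly.span (monomials_upto (max M N))" "q \<in> mpoly.span (monomials_upto (max M N))"
    by (auto elim!: subsetD[OF mpoly.span_mono[OF monomials_upto_mono], rotated])
  then show ?case by (blast intro: mpoly.span_add)
qed

section \<open>Polynomials in a quotient, with denominators cleared\<close>

text \<open>For \<open>degree p \<le> n\<close> this is \<open>s ^ n * p (t / s)\<close>, expressed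
  without fractions.\<close>

definition homogenize :: "('v, 'a::comm_ring_1) mpoly \<Rightarrow> ('v, 'a) mpoly \<Rightarrow> nat \<Rightarrow> 'a poly \<Rightarrow> ('v, 'a) mpoly" where
  "homogenize t s n p = (\<Sum>i\<le>n. Const (coeff p i) * (t ^ i * s ^ (n - i)))"

lemma homogenize_pCons:
  "homogenize t s (Suc n) (pCons a p) = Const a * s ^ Suc n + t * homogenize t s n p"
  by (simp add: homogenize_def sum.atMost_Suc_shift sum_distrib_left mult_ac del: sum.atMost_Suc)

lemma homogenize_Suc:
  assumes "degree p \<le> n"
  shows "homogenize t s (Suc n) p = s * homogenize t s n p"
proof -
  have "coeff p (Suc n) = 0" using assms by (simp add: coeff_eq_0)
  then show ?thesis
    by (simp add: homogenize_def sum_distrib_left Suc_diff_le mult_ac)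
qed

lemma homogenize_add: "homogenize t s n (p + q) = homogenize t s n p + homogenize t s n q"
  by (simp add: homogenize_def Const_add distrib_right sum.distrib)

lemma homogenize_smult: "homogenize t s n (smult c p) = Const c * homogenize t s n p"
  by (simp add: homogenize_def Const_mult sum_distrib_left mult.assoc)

lemma homogenize_sum: "homogenize t s n (\<Sum>i\<in>I. f i) = (\<Sum>i\<in>I. homogenize t s n (f i))"
  by (induction I rule: infinite_finite_induct) (simp_all add: homogenize_add, simp_all add: homogenize_def)

lemma homogenize_linear_mult:
  assumes "degree p \<le> n"
  shows "homogenize t s (Suc n) ([:-l, 1:] * p) = (t - Const l * s) * homogenize t s n p"
proof -
  have "[:-l, 1:] * p = smult (-l) p + pCons 0 p" by simp
  then have "homogenize t s (Suc n) ([:-l, 1:] * p) = Const (-l) * (s * homogenize t s n p) + t * homogenize t s n p"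
    by (simp only: homogenize_add homogenize_smult homogenize_pCons homogenize_Suc[OF assms]) simp
  also have "Const (-l) = - Const l"
    using Const_diff[of 0 l] by simp
  finally show ?thesis by (simp add: algebra_simps)
qed

lemma homogenize_prod_linear:
  assumes "finite A"
  shows "homogenize t s (card A) (\<Prod>l\<in>A. [:-l, 1:]) = (\<Prod>l\<in>A. t - Const l * s)"
  using assms
proof (induction A rule: finite_induct)
  case (insert l A)
  have "degree (\<Prod>l\<in>A. [:-l, 1:]) \<le> (\<Sum>l\<in>A. degree [:-l, 1:])"
    using degree_prod_sum_le[OF insert(1), of "\<lambda>l. [:-l, 1:]"] by (simp add: o_def)
  then have "degree (\<Prod>l\<in>A. [:-l, 1:]) \<le> card A" by simp
  from homogenize_linear_mult[OF this, of t s l] insert show ?case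
    by (simp del: mult_pCons_left)
qed (simp add: homogenize_def)

text \<open>Over the complex numbers \<open>p\<close> splits, so its homogenization is a product of
  a nonzero constant, powers of \<open>s\<close> and factors \<open>t - Const d * s\<close>. Only
  factors of the last kind can lie in the prime ideal \<open>Q\<close>.\<close>

lemma prime_ideal_homogenize_factor:
  fixes t s :: "('v, complex) mpoly"
  assumes Q: "is_prime_ideal Q" and s: "s \<notin> Q"
  shows "degree p \<le> n \<Longrightarrow> p \<noteq> 0 \<Longrightarrow> homogenize t s n p \<in> Q \<Longrightarrow> \<exists>d. t - Const d * s \<in> Q"
proof (induction n arbitrary: p)
  case 0
  then obtain a where a: "p = [:a:]" "a \<noteq> 0" by (auto elim: degree_eq_zeroE)
  with 0 have "Const a \<in> Q" by (simp add: homogenize_def)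
  then have "Const (inverse a) * Const a \<in> Q" by (intro ideal_mult prime_ideal_is_ideal[OF Q])
  then have "1 \<in> Q" using a by (simp flip: Const_mult)
  then show ?case using Q by (simp add: is_prime_ideal_def)
next
  case (Suc n)
  show ?case
  proof (cases "degree p \<le> n")
    case True
    then show ?thesis using Suc s prime_idealD[OF Q] homogenize_Suc[OF True, of t s] by metis
  next
    case False
    then have "\<not> constant (poly p)" by (simp add: constant_degree)
    then obtain d where "poly p d = 0" using fundamental_theorem_of_algebra by blast
    then obtain r where r: "p = [:-d, 1:] * r" by (auto simp: poly_eq_0_iff_dvd dvd_def)
    with Suc.prems have "r \<noteq> 0" by auto
    then have "degree p = Suc (degree r)" unfolding r by (subst degree_mult_eq) auto
    with Suc.prems have deg: "degree r \<le> n" by simp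
    show ?thesis
      using Suc.prems(3) prime_idealD[OF Q] Suc.IH[OF deg \<open>r \<noteq> 0\<close>]
      unfolding r homogenize_linear_mult[OF deg] by blast
  qed
qed

text \<open>Modulo \<open>Q\<close>, \<open>g c\<close> stands for
  \<open>f ^ n / (t - Const c * s)\<close>. Multiplying the dependence by all denominators and
  cancelling \<open>f ^ n\<close> leaves a nonzero polynomial in \<open>t / s\<close> that vanishes
  modulo \<open>Q\<close>; one of its linear factors must then lie in \<open>Q\<close>.\<close>

lemma prime_ideal_linear_dependence:
  fixes t s f :: "('v, complex) mpoly"
  assumes Q: "is_prime_ideal Q" and f: "f \<notin> Q" and s: "s \<notin> Q" and T: "finite T"
    and g: "\<And>c. c \<in> T \<Longrightarrow> (t - Const c * s) * g c - f ^ n \<in> Q"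
    and dep: "(\<Sum>c\<in>T. Const (a c) * g c) = 0" and c0: "c0 \<in> T" "a c0 \<noteq> 0"
  shows "\<exists>d. t - Const d * s \<in> Q"
proof -
  note I = prime_ideal_is_ideal[OF Q]
  \<comment> \<open>The numerator of the sum of \<open>a c / (X - c)\<close> over the common
    denominator.\<close>
  define p where "p = (\<Sum>c\<in>T. smult (a c) (\<Prod>l\<in>T - {c}. [:-l, 1:]))"
  define e where "e c = (\<Prod>l\<in>T - {c}. t - Const l * s)" for c
  have deg: "degree (\<Prod>l\<in>T - {c}. [:-l, 1:]) \<le> card T - 1" if "c \<in> T" for c
    using degree_prod_sum_le[of "T - {c}" "\<lambda>l. [:-l, 1:]"] T that by (simp add: o_def)
  have hom: "homogenize t s (card T - 1) p = (\<Sum>c\<in>T. Const (a c) * e c)"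
    unfolding p_def homogenize_sum homogenize_smult e_def
  proof (rule sum.cong[OF refl])
    fix c assume "c \<in> T"
    then have "card (T - {c}) = card T - 1" using T by simp
    then show "Const (a c) * homogenize t s (card T - 1) (\<Prod>l\<in>T - {c}. [:-l, 1:]) =
        Const (a c) * (\<Prod>l\<in>T - {c}. t - Const l * s)"
      using homogenize_prod_linear[of "T - {c}" t s] T by simp
  qed
  have eq: "(t - Const c * s) * e c = (\<Prod>l\<in>T. t - Const l * s)" if "c \<in> T" for c
    using prod.remove[OF T that, of "\<lambda>l. t - Const l * s"] by (simp add: e_def)
  have "f ^ n * homogenize t s (card T - 1) p =
      (\<Sum>c\<in>T. Const (a c) * e c * f ^ n)"
    unfolding hom sum_distrib_left by (simp add: mult_ac)
  \<comment> \<open>The difference \<open>(t - Const c * s) * g c - f ^ n\<close>, which lies in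
    \<open>Q\<close>, is split off to trade \<open>f ^ n\<close> for \<open>g c\<close>.\<close>
  also have "\<dots> = (\<Sum>c\<in>T. (t - Const c * s) * e c * (Const (a c) * g c)
      - (Const (a c) * e c) * ((t - Const c * s) * g c - f ^ n))"
    by (intro sum.cong) (simp_all add: algebra_simps)
  also have "\<dots> = (\<Prod>l\<in>T. t - Const l * s) * (\<Sum>c\<in>T. Const (a c) * g c)
      - (\<Sum>c\<in>T. (Const (a c) * e c) * ((t - Const c * s) * g c - f ^ n))"
    by (simp add: sum_subtractf sum_distrib_left eq)
  also have "\<dots> \<in> Q"
    by (rule ideal_diff[OF I _ ideal_sum[OF I ideal_mult[OF I g]]]) (simp_all add: dep ideal_zero[OF I])
  finally have "homogenize t s (card T - 1) p \<in> Q"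
    using prime_idealD[OF Q] prime_ideal_power[OF Q] f by blast
  moreover have "degree p \<le> card T - 1"
    unfolding p_def using deg by (intro degree_sum_le[OF T]) (meson degree_smult_le le_trans)
  moreover have "p \<noteq> 0"
  proof -
    \<comment> \<open>As in Lagrange interpolation, every other summand contains the factor
      \<open>c0 - c0\<close>.\<close>
    have "poly p c0 = (\<Sum>c\<in>T. a c * (\<Prod>l\<in>T - {c}. c0 - l))"
      by (simp add: p_def poly_sum poly_prod)
    also have "\<dots> = (\<Sum>c\<in>T. if c = c0 then a c0 * (\<Prod>l\<in>T - {c0}. c0 - l) else 0)"
      using T c0 by (intro sum.cong) auto
    also have "\<dots> = a c0 * (\<Prod>l\<in>T - {c0}. c0 - l)"
      using T c0 by simp
    also have "\<dots> \<noteq> 0" using T c0 by simp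
    finally show ?thesis by auto
  qed
  ultimately show ?thesis using prime_ideal_homogenize_factor[OF Q s] by blast
qed

text \<open>The witnesses \<open>g\<close> play the role of \<open>f\<^sup>n / (t - c s)\<close>.  The polynomial ring has
  countable dimension, so uncountably many of them are linearly dependent.\<close>

lemma prime_ideal_contains_line:
  fixes t s f :: "('v::finite, complex) mpoly"
  assumes Q: "is_prime_ideal Q" and f: "f \<notin> Q" and s: "s \<notin> Q" and C: "uncountable C"
    and ex: "\<And>c. c \<in> C \<Longrightarrow> \<exists>n g. (t - Const c * s) * g - f ^ n \<in> Q"
  shows "\<exists>d. t - Const d * s \<in> Q"
proof -
  note I = prime_ideal_is_ideal[OF Q]
  from ex obtain n g where ng: "\<And>c. c \<in> C \<Longrightarrow> (t - Const c * s) * g c - f ^ n c \<in> Q"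
    by metis
  have "\<forall>c. \<exists>N. g c \<in> mpoly.span (monomials_upto N)"
    by (intro allI mpoly_in_span_monomials_upto)
  then obtain N where N: "\<And>c. g c \<in> mpoly.span (monomials_upto (N c))"
    by (auto dest!: choice)
  \<comment> \<open>There are countably many pairs of an exponent and a bound, so infinitely many
    parameters share both. Their witnesses lie in one finite-dimensional space.\<close>
  have "\<exists>k M. infinite {c \<in> C. n c = k \<and> N c = M}"
  proof (rule ccontr)
    assume "\<nexists>k M. infinite {c \<in> C. n c = k \<and> N c = M}"
    then have "countable (\<Union>k. \<Union>M. {c \<in> C. n c = k \<and> N c = M})"
      by (intro countable_UN) (auto intro: countable_finite)
    moreover have "C \<subseteq> (\<Union>k. \<Union>M. {c \<in> C. n c = k \<and> N c = M})" by auto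
    ultimately show False using C countable_subset by blast
  qed
  then obtain k M where inf: "infinite {c \<in> C. n c = k \<and> N c = M}" by blast
  define D where "D = {c \<in> C. n c = k \<and> N c = M}"
  have g: "(t - Const c * s) * g c - f ^ k \<in> Q" if "c \<in> D" for c
    using ng that by (auto simp: D_def)
  \<comment> \<open>Dependence concerns the set of witnesses, so distinct parameters must have
    distinct ones. If two agreed, subtracting their relations would put \<open>s * g c\<close>,
    hence \<open>g c\<close>, hence a power of \<open>f\<close> into \<open>Q\<close>.\<close>
  have inj: "inj_on g D"
  proof (rule inj_onI, rule ccontr)
    fix c d assume cd: "c \<in> D" "d \<in> D" "g c = g d" "c \<noteq> d"
    have "((t - Const c * s) * g c - f ^ k) - ((t - Const d * s) * g c - f ^ k) \<in> Q"
      by (rule ideal_diff[OF I g[OF cd(1)]]) (use g[OF cd(2)] cd(3) in simp)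
    also have "((t - Const c * s) * g c - f ^ k) - ((t - Const d * s) * g c - f ^ k) =
        Const (d - c) * (s * g c)"
      by (simp add: Const_diff algebra_simps)
    finally have "Const (inverse (d - c)) * (Const (d - c) * (s * g c)) \<in> Q"
      by (rule ideal_mult[OF I])
    then have "s * g c \<in> Q"
      using cd(4) by (simp flip: mult.assoc Const_mult)
    then have "g c \<in> Q" using s prime_idealD[OF Q] by blast
    then have "f ^ k \<in> Q"
      using ideal_iff_of_diff[OF I g[OF cd(1)]] ideal_mult[OF I] by blast
    then show False using f prime_ideal_power[OF Q] by blast
  qed
  have "g ` D \<subseteq> mpoly.span (monomials_upto M)" using N by (auto simp: D_def)
  moreover have "infinite (g ` D)" using inf inj by (simp add: D_def finite_image_iff)
  ultimately have "mpoly.dependent (g ` D)"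
    using mpoly.independent_span_bound[OF finite_monomials_upto] by blast
  then obtain U u where U: "finite U" "U \<subseteq> g ` D" "(\<Sum>v\<in>U. Const (u v) * v) = 0" "\<exists>v\<in>U. u v \<noteq> 0"
    unfolding mpoly.dependent_explicit by blast
  then obtain T where T: "T \<subseteq> D" "U = g ` T"
    by (meson subset_image_iff)
  have injT: "inj_on g T" using inj T(1) inj_on_subset by blast
  then have "finite T" using U(1) T(2) finite_imageD by blast
  moreover have "(\<Sum>c\<in>T. Const (u (g c)) * g c) = 0"
    using U(3) sum.reindex[OF injT, of "\<lambda>v. Const (u v) * v"] by (simp add: T(2))
  moreover obtain c0 where "c0 \<in> T" "u (g c0) \<noteq> 0" using U(4) T(2) by auto
  ultimately show ?thesis
    using prime_ideal_linear_dependence[OF Q f s, of T t g k "\<lambda>c. u (g c)" c0] g T(1) by blast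
qed

section \<open>Hilbert's Nullstellensatz over the complex numbers\<close>

text \<open>Modulo an ideal \<open>M\<close> maximal among those avoiding the powers of
  \<open>f\<close>, each variable is congruent to a constant. These constants are the coordinates of
  the point, and reduction modulo \<open>M\<close> is evaluation there.\<close>

lemma ideal_common_zero:
  fixes f :: "('v::finite, complex) mpoly"
  assumes I: "is_ideal I" and f: "\<And>n. f ^ n \<notin> I"
  obtains x where "\<And>p. p \<in> I \<Longrightarrow> insertion x p = 0" "insertion x f \<noteq> 0"
proof -
  from exists_maximal_ideal_avoiding_powers[OF assms] obtain M where M: "I \<subseteq> M" "is_prime_ideal M" "f \<notin> M"
    and ex: "\<And>a. a \<notin> M \<Longrightarrow> \<exists>n r. a * r - f ^ n \<in> M" by blast
  note IM = prime_ideal_is_ideal[OF M(2)]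
  have one: "1 \<notin> M" using M(2) by (simp add: is_prime_ideal_def)
  have "\<exists>d. Var i - Const d * 1 \<in> M" for i
  proof (rule ccontr)
    assume none: "\<nexists>d. Var i - Const d * 1 \<in> M"
    \<comment> \<open>If every \<open>Var i - Const c\<close> lies outside \<open>M\<close>, each
      divides a power of \<open>f\<close> modulo \<open>M\<close>, which is what
      \<open>prime_ideal_contains_line\<close> asks for with \<open>s = 1\<close>.\<close>
    then have "\<exists>n g. (Var i - Const c * 1) * g - f ^ n \<in> M" for c
      using ex by blast
    then show False
      using prime_ideal_contains_line[OF M(2,3) one uncountable_UNIV_complex, of "Var i"] none by blast
  qed
  then obtain x where x: "\<And>i. Var i - Const (x i) \<in> M" by (metis mult_1_right)
  have cong: "p - Const (insertion x p) \<in> M" for p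
  proof (induction p rule: mpoly_induct)
    case (add p q)
    from ideal_add[OF IM add] show ?case by (simp add: insertion_add Const_add algebra_simps)
  next
    case (mult p q)
    have "p * q - Const (insertion x (p * q)) =
        q * (p - Const (insertion x p)) + Const (insertion x p) * (q - Const (insertion x q))"
      by (simp add: insertion_mult Const_mult algebra_simps)
    then show ?case using mult IM by (simp add: ideal_add ideal_mult)
  qed (use x ideal_zero[OF IM] in auto)
  have zero: "insertion x p = 0" if "p \<in> M" for p
  proof (rule ccontr)
    assume nz: "insertion x p \<noteq> 0"
    have "Const (insertion x p) \<in> M" using ideal_iff_of_diff[OF IM cong] that by blast
    then have "Const (inverse (insertion x p)) * Const (insertion x p) \<in> M" by (rule ideal_mult[OF IM])
    then show False using nz one by (simp flip: Const_mult)
  qed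
  have "insertion x f \<noteq> 0" using cong[of f] M(3) by auto
  then show ?thesis using that zero M(1) by blast
qed

section \<open>Quotients on irreducible varieties\<close>

lemma algebraic_variety_Int_zeros:
  assumes "algebraic_variety W"
  shows "algebraic_variety {z \<in> W. insertion (($) z) p = 0}"
proof -
  from assms obtain P :: "('a, complex) mpoly set" where "W = {z. \<forall>p\<in>P. insertion (($) z) p = 0}"
    by (auto simp: algebraic_variety_def)
  then have "{z \<in> W. insertion (($) z) p = 0} = {z. \<forall>p\<in>insert p P. insertion (($) z) p = 0}"
    by auto
  then show ?thesis unfolding algebraic_variety_def by blast
qed

text \<open>Complex coefficients, unlike in \<open>vanishing_ideal\<close>: the arguments on prime
  ideals take place over an algebraically closed field.\<close>

definition variety_ideal :: "(complex ^ 'n) set \<Rightarrow> ('n, complex) mpoly set" where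
  "variety_ideal W = {p. \<forall>z\<in>W. insertion (($) z) p = 0}"

text \<open>If a product vanishes on \<open>W\<close>, the zero sets of its factors cover
  \<open>W\<close>, so irreducibility makes one of them all of \<open>W\<close>. Nonemptiness keeps
  1 out of the ideal.\<close>

lemma variety_ideal_prime:
  assumes "irreducible_variety W"
  shows "is_prime_ideal (variety_ideal W)"
proof -
  have W: "algebraic_variety W" "W \<noteq> {}"
    using assms by (auto simp: irreducible_variety_def)
  have "p \<in> variety_ideal W \<or> q \<in> variety_ideal W" if pq: "p * q \<in> variety_ideal W" for p q
  proof (rule ccontr)
    assume *: "\<not> (p \<in> variety_ideal W \<or> q \<in> variety_ideal W)"
    let ?A = "{z \<in> W. insertion (($) z) p = 0}" and ?B = "{z \<in> W. insertion (($) z) q = 0}"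
    have "?A \<subset> W" "?B \<subset> W" using * by (auto simp: variety_ideal_def)
    moreover have "W = ?A \<union> ?B" using pq by (auto simp: variety_ideal_def insertion_mult)
    ultimately have "\<exists>A B. algebraic_variety A \<and> algebraic_variety B \<and> A \<subset> W \<and> B \<subset> W \<and> W = A \<union> B"
      by (intro exI[of _ ?A] exI[of _ ?B] conjI algebraic_variety_Int_zeros[OF W(1)])
    moreover have "\<nexists>A B. algebraic_variety A \<and> algebraic_variety B \<and> A \<subset> W \<and> B \<subset> W \<and> W = A \<union> B"
      using assms unfolding irreducible_variety_def by (elim conjE)
    ultimately show False by contradiction
  qed
  moreover have "is_ideal (variety_ideal W)"
    using insertion_Const[of _ 0]
    by (auto simp: is_ideal_def variety_ideal_def insertion_add insertion_mult simp del: insertion_Const)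
  ultimately show ?thesis
    using W(2) by (auto simp: is_prime_ideal_def variety_ideal_def)
qed

lemma uncountable_nonreal: "uncountable (- \<real> :: complex set)"
proof -
  have "range (\<lambda>x. Complex x 1) \<subseteq> - \<real>"
    by (auto simp: complex_is_Real_iff)
  moreover have "uncountable (range (\<lambda>x. Complex x 1))"
    using uncountable_UNIV_real by (auto dest!: countable_image_inj_on intro!: inj_onI)
  ultimately show ?thesis using countable_subset by blast
qed

text \<open>For nonreal \<open>c\<close> the function \<open>f - c g\<close> has no zero on the open set \<open>g \<noteq> 0\<close> of \<open>W\<close>,
  so it divides a power of \<open>g\<close> in the coordinate ring.\<close>

lemma real_quotient_is_constant:
  fixes f g :: "('n::finite, complex) mpoly"
  assumes W: "irreducible_variety W"
    and g: "\<exists>z\<in>W. insertion (($) z) g \<noteq> 0"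
    and real: "\<And>z. z \<in> W \<Longrightarrow> insertion (($) z) f * cnj (insertion (($) z) g) \<in> \<real>"
  shows "\<exists>d. \<forall>z\<in>W. insertion (($) z) f = d * insertion (($) z) g"
proof -
  let ?Q = "variety_ideal W"
  have Q: "is_prime_ideal ?Q" by (rule variety_ideal_prime[OF W])
  note I = prime_ideal_is_ideal[OF Q]
  have gQ: "g \<notin> ?Q" using g by (auto simp: variety_ideal_def)
  have "\<exists>n h. (f - Const c * g) * h - g ^ n \<in> ?Q" if c: "c \<in> - \<real>" for c
  proof -
    let ?J = "{m + r * (f - Const c * g) | m r. m \<in> ?Q}"
    have J: "is_ideal ?J" by (rule is_ideal_adjoin[OF I])
    \<comment> \<open>Otherwise the Nullstellensatz yields a point of \<open>W\<close> where
      \<open>g\<close> is nonzero and the quotient of \<open>f\<close> by \<open>g\<close> is the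
      nonreal number \<open>c\<close>.\<close>
    have "\<exists>n. g ^ n \<in> ?J"
    proof (rule ccontr)
      assume "\<nexists>n. g ^ n \<in> ?J"
      then obtain x where x: "\<And>p. p \<in> ?J \<Longrightarrow> insertion x p = 0" "insertion x g \<noteq> 0"
        using ideal_common_zero[OF J, of g] by blast
      define z :: "complex ^ 'n" where "z = (\<chi> i. x i)"
      have xz: "x = ($) z" by (auto simp: z_def)
      have "p \<in> ?J" if "p \<in> ?Q" for p using that by (force intro: exI[of _ 0])
      then have "insertion (($) z) p = 0" if "p \<in> ?Q" for p using x(1) that xz by blast
      moreover obtain P :: "('n, complex) mpoly set" where P: "W = {z. \<forall>p\<in>P. insertion (($) z) p = 0}"
        using W by (auto simp: irreducible_variety_def algebraic_variety_def)
      moreover have "P \<subseteq> ?Q" using P by (auto simp: variety_ideal_def)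
      ultimately have "z \<in> W" by blast
      have "f - Const c * g \<in> ?J" using ideal_zero[OF I] by (force intro: exI[of _ 1])
      then have "insertion (($) z) f = c * insertion (($) z) g"
        using x(1) xz by (fastforce simp: insertion_diff insertion_mult)
      with real[OF \<open>z \<in> W\<close>] have "c * (insertion (($) z) g * cnj (insertion (($) z) g)) \<in> \<real>"
        by (simp add: mult.assoc)
      then have "c * (insertion (($) z) g * cnj (insertion (($) z) g)) /
          (insertion (($) z) g * cnj (insertion (($) z) g)) \<in> \<real>"
        by (intro Reals_divide) (auto simp: complex_is_Real_iff)
      then show False using c x(2) xz by simp
    qed
    then obtain n m r where mr: "g ^ n = m + r * (f - Const c * g)" "m \<in> ?Q" by blast
    have "(f - Const c * g) * r - g ^ n = - 1 * m" using mr by (simp add: algebra_simps)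
    then show ?thesis using ideal_mult[OF I mr(2)] by metis
  qed
  \<comment> \<open>Here \<open>g\<close> is both the denominator of the quotient and the element
    that is inverted.\<close>
  from prime_ideal_contains_line[OF Q gQ gQ uncountable_nonreal this]
  obtain d where "f - Const d * g \<in> ?Q" by blast
  then show ?thesis
    by (auto simp: variety_ideal_def insertion_diff insertion_mult intro!: exI[of _ d])
qed

section \<open>Poised tuples\<close>

lemma insertion_complexify_cnj:
  "insertion (\<lambda>i. cnj (x i)) (complexify p) = cnj (insertion x (complexify p))"
  by (simp add: insertion_complexify)

text \<open>Real polynomials take conjugate values at conjugate points, so vanishing on
  \<open>W\<close> carries over to its conjugate.\<close>

lemma coord_fun_zero_iff:
  assumes "V = W \<union> vec_cnj ` W" "q \<in> real_coord_ring V"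
  shows "q = 0 \<longleftrightarrow> (\<forall>z\<in>W. q z = 0)"
proof
  assume *: "\<forall>z\<in>W. q z = 0"
  obtain p where p: "q = coord_fun V p" using assms(2) by (auto simp: real_coord_ring_def)
  have "q z = 0" if zV: "z \<in> V" for z
  proof (cases "z \<in> W")
    case False
    then obtain w where w: "w \<in> W" "z = vec_cnj w" using zV assms(1) by blast
    have "($) (vec_cnj w) = (\<lambda>i. cnj (w $ i))" by (simp add: vec_cnj_def fun_eq_iff)
    then have "q z = cnj (q w)"
      using w assms(1) by (simp add: p coord_fun_def flip: insertion_complexify_cnj)
    then show ?thesis using * w by simp
  qed (use * in blast)
  then show "q = 0" by (auto simp: fun_eq_iff p coord_fun_def)
qed auto

text \<open>If all these products were real, \<open>q1\<close> would be a constant multiple of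
  \<open>q2\<close> on \<open>W\<close>, with a factor that turns out to be real.\<close>

lemma exists_sample_nonreal_quotient:
  assumes W: "irreducible_variety W" and V: "V = W \<union> vec_cnj ` W"
    and q: "q1 \<in> real_coord_ring V" "q2 \<in> real_coord_ring V" "q1 \<notin> span {q2}" "q2 \<noteq> 0"
  shows "\<exists>z\<in>W. q1 z * cnj (q2 z) \<notin> \<real>"
proof (rule ccontr)
  assume *: "\<not> (\<exists>z\<in>W. q1 z * cnj (q2 z) \<notin> \<real>)"
  obtain p1 p2 where p: "q1 = coord_fun V p1" "q2 = coord_fun V p2"
    using q by (auto simp: real_coord_ring_def)
  have ins: "insertion (($) z) (complexify p1) = q1 z" "insertion (($) z) (complexify p2) = q2 z"
    if "z \<in> W" for z
    using that V by (auto simp: p coord_fun_def)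
  obtain w where w: "w \<in> W" "q2 w \<noteq> 0" using coord_fun_zero_iff[OF V q(2)] q(4) by blast
  have "\<exists>d. \<forall>z\<in>W. insertion (($) z) (complexify p1) = d * insertion (($) z) (complexify p2)"
    by (rule real_quotient_is_constant[OF W]) (use * ins w in auto)
  then obtain d where d: "\<And>z. z \<in> W \<Longrightarrow> q1 z = d * q2 z" using ins by auto
  \<comment> \<open>Expanding by \<open>cnj (q2 w)\<close> makes numerator and denominator
    real.\<close>
  have "d = q1 w * cnj (q2 w) / (q2 w * cnj (q2 w))" using d w by simp
  also have "\<dots> \<in> \<real>" using * w by (intro Reals_divide) (auto simp: complex_is_Real_iff)
  finally obtain r where r: "d = of_real r" by (auto elim: Reals_cases)
  have "q1 - r *\<^sub>R q2 \<in> real_coord_ring V"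
    using q subspace_real_coord_ring by (intro subspace_diff subspace_scale) auto
  then have "q1 - r *\<^sub>R q2 = 0"
    unfolding coord_fun_zero_iff[OF V \<open>q1 - r *\<^sub>R q2 \<in> real_coord_ring V\<close>]
    using d r by (simp add: scaleR_fun_def scaleR_conv_of_real)
  then have "q1 \<in> span {q2}" by (auto simp: span_singleton)
  then show False using q by blast
qed

text \<open>A nonreal \<open>q1 z * cnj (q2 z)\<close> means that \<open>q1 z\<close> and
  \<open>q2 z\<close> are linearly independent over the reals, so evaluation at \<open>z\<close>
  maps \<open>L\<close> onto the complex plane and its kernel has codimension 2. In dimensions 0 and
  1 the bound truncates to 0 and the kernel must be trivial.\<close>

lemma exists_sample_dim_decreasing:
  assumes W: "irreducible_variety W" and V: "V = W \<union> vec_cnj ` W"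
    and L: "L \<subseteq> real_coord_ring V" "subspace L" "finite B" "L \<subseteq> span B"
  shows "\<exists>z\<in>W. dim {q \<in> L. q z = 0} \<le> dim L - 2"
proof (cases "L \<subseteq> {0}")
  case True
  then have "dim {q \<in> L. q z = 0} = 0" for z using dim_le_card[of "{q \<in> L. q z = 0}" "{}"] by auto
  moreover have "W \<noteq> {}" using W by (auto simp: irreducible_variety_def)
  ultimately show ?thesis by auto
next
  case False
  then obtain q2 where q2: "q2 \<in> L" "q2 \<noteq> 0" by blast
  show ?thesis
  proof (cases "L \<subseteq> span {q2}")
    case True
    obtain z where z: "z \<in> W" "q2 z \<noteq> 0" using coord_fun_zero_iff[OF V] q2 L by blast
    have K0: "{q \<in> L. q z = 0} \<subseteq> span {}"
      using True z by (fastforce simp: span_singleton scaleR_fun_def)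
    then have "dim {q \<in> L. q z = 0} = 0" using dim_le_card[OF K0] by simp
    then show ?thesis using z(1) by (intro bexI[of _ z]) simp_all
  next
    case False
    then obtain q1 where q1: "q1 \<in> L" "q1 \<notin> span {q2}" by blast
    obtain z where z: "z \<in> W" "q1 z * cnj (q2 z) \<notin> \<real>"
      using exists_sample_nonreal_quotient[OF W V] q1 q2 L(1) by blast
    let ?K = "{q \<in> L. q z = 0}"
    have K: "subspace ?K"
      using L(2) by (auto simp: subspace_def scaleR_fun_def)
    obtain C where C: "C \<subseteq> ?K" "independent C" "?K \<subseteq> span C" "card C = dim ?K"
      using basis_exists by blast
    have spanC: "span C = ?K" by (intro subset_antisym span_minimal C K)
    \<comment> \<open>A basis of the kernel stays independent when \<open>q2\<close> and then
      \<open>q1\<close> are added.\<close>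
    have "q2 \<notin> span C" using z by (auto simp: spanC)
    then have ind2: "independent (insert q2 C)" using C by (auto simp: independent_insert)
    have "q1 \<notin> span (insert q2 C)"
    proof
      assume "q1 \<in> span (insert q2 C)"
      then obtain r where "q1 - r *\<^sub>R q2 \<in> ?K" unfolding span_insert spanC by blast
      then have "q1 z = of_real r * q2 z" by (simp add: scaleR_fun_def scaleR_conv_of_real)
      then have "q1 z * cnj (q2 z) \<in> \<real>" by (auto simp: mult.assoc complex_is_Real_iff)
      then show False using z by blast
    qed
    then have ind: "independent (insert q1 (insert q2 C))" using ind2 by (simp add: independent_insert)
    obtain E where E: "E \<subseteq> L" "independent E" "L \<subseteq> span E" "card E = dim L"
      using basis_exists by blast
    have "finite E" using independent_span_bound[OF L(3) E(2)] E(1) L(4) by blast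
    have sub: "insert q1 (insert q2 C) \<subseteq> span E" using C(1) q1 q2 E(3) by blast
    have "finite (insert q1 (insert q2 C))" "card (insert q1 (insert q2 C)) \<le> dim L"
      using independent_span_bound[OF \<open>finite E\<close> ind sub] E(4) by simp_all
    moreover have "q2 \<notin> C" using \<open>q2 \<notin> span C\<close> span_base by blast
    moreover have "q1 \<notin> insert q2 C" using \<open>q1 \<notin> span (insert q2 C)\<close> span_base by blast
    ultimately have "card C + 2 \<le> dim L" by auto
    then show ?thesis using z(1) C(4) by (intro bexI[of _ z]) auto
  qed
qed

text \<open>The induction hypothesis is applied to the elements of \<open>L\<close> that vanish at
  the new sample. The finite set \<open>B\<close> carries finite-dimensionality to all these
  subspaces.\<close>

lemma exists_poised_tuple:
  assumes W: "irreducible_variety W" and V: "V = W \<union> vec_cnj ` W"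
    and B: "finite B"
  shows "L \<subseteq> real_coord_ring V \<Longrightarrow> subspace L \<Longrightarrow> L \<subseteq> span B \<Longrightarrow> dim L \<le> 2 * S \<Longrightarrow>
    \<exists>Z\<in>tuples S W. poised L (set Z)"
proof (induction S arbitrary: L)
  case 0
  obtain E where E: "E \<subseteq> L" "independent E" "L \<subseteq> span E" "card E = dim L"
    using basis_exists by blast
  \<comment> \<open>Finiteness comes first, since \<open>card E = 0\<close> also holds for infinite
    \<open>E\<close>.\<close>
  have "finite E" using independent_span_bound[OF B E(2)] E(1) 0 by blast
  then have "E = {}" using E(4) 0 by simp
  then have "L \<subseteq> {0}" using E(3) by simp
  then show ?case by (auto simp: tuples_def poised_def)
next
  case (Suc S)
  obtain z where z: "z \<in> W" "dim {q \<in> L. q z = 0} \<le> dim L - 2"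
    using exists_sample_dim_decreasing[OF W V Suc.prems(1,2) B Suc.prems(3)] by blast
  have "subspace {q \<in> L. q z = 0}"
    using Suc.prems(2) by (auto simp: subspace_def scaleR_fun_def)
  moreover have "dim {q \<in> L. q z = 0} \<le> 2 * S" 
    by (rule le_trans[OF z(2)]) (use Suc.prems(4) in simp)
  ultimately obtain Z where "Z \<in> tuples S W" "poised {q \<in> L. q z = 0} (set Z)"
    using Suc.IH[of "{q \<in> L. q z = 0}"] Suc.prems(1,3) by blast
  then show ?case
    using z(1) by (intro bexI[of _ "z # Z"]) (auto simp: tuples_def poised_def)
qed

section \<open>The Gram determinant\<close>

text \<open>Stated for entry functions, the determinant is visibly an integer polynomial in its
  entries.\<close>

definition leibniz_det :: "nat \<Rightarrow> (nat \<Rightarrow> nat \<Rightarrow> 'a::comm_ring_1) \<Rightarrow> 'a" where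
  "leibniz_det n a = (\<Sum>\<sigma> | \<sigma> permutes {0..<n}. of_int (sign \<sigma>) * (\<Prod>i = 0..<n. a i (\<sigma> i)))"

lemma leibniz_det_eq_0_iff:
  fixes a :: "nat \<Rightarrow> nat \<Rightarrow> 'a::field"
  shows "leibniz_det n a = 0 \<longleftrightarrow> (\<exists>v. (\<exists>i<n. v i \<noteq> 0) \<and> (\<forall>i<n. (\<Sum>j<n. a i j * v j) = 0))"
proof -
  define A where "A = Matrix.mat n n (\<lambda>(i, j). a i j)"
  have A: "A \<in> carrier_mat n n" by (simp add: A_def)
  have "leibniz_det n a = Determinant.det A"
    unfolding leibniz_det_def det_def'[OF A]
    by (intro sum.cong refl arg_cong2[of _ _ _ _ "(*)"] prod.cong)
      (auto simp: A_def permutes_in_image)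
  moreover have mult: "vec_index (A *\<^sub>v v) i = (\<Sum>j<n. a i j * vec_index v j)"
    if "v \<in> carrier_vec n" "i < n" for v i
    using that by (simp add: A_def scalar_prod_def atLeast0LessThan)
  moreover have "(\<exists>v. v \<in> carrier_vec n \<and> v \<noteq> 0\<^sub>v n \<and> A *\<^sub>v v = 0\<^sub>v n) \<longleftrightarrow>
    (\<exists>v. (\<exists>i<n. v i \<noteq> 0) \<and> (\<forall>i<n. (\<Sum>j<n. a i j * v j) = 0))" (is "?l \<longleftrightarrow> ?r")
  proof
    assume ?l
    then obtain v where v: "v \<in> carrier_vec n" "v \<noteq> 0\<^sub>v n" "A *\<^sub>v v = 0\<^sub>v n" by blast
    have "\<exists>i<n. vec_index v i \<noteq> 0" using v(1,2) by (metis eq_vecI carrier_vecD index_zero_vec(1,2))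
    moreover have "\<forall>i<n. (\<Sum>j<n. a i j * vec_index v j) = 0"
      using mult[OF v(1)] v(3) by (metis index_zero_vec(1))
    ultimately show ?r by blast
  next
    assume ?r
    then obtain v where v: "\<exists>i<n. v i \<noteq> 0" "\<And>i. i < n \<Longrightarrow> (\<Sum>j<n. a i j * v j) = 0" by blast
    let ?v = "Matrix.vec n v"
    have "A *\<^sub>v ?v = 0\<^sub>v n"
    proof (rule eq_vecI)
      fix i assume "i < dim_vec (0\<^sub>v n :: 'a Matrix.vec)"
      then show "vec_index (A *\<^sub>v ?v) i = vec_index (0\<^sub>v n) i"
        using v(2) mult[of ?v i] by simp
    qed (simp add: A_def)
    moreover have "?v \<noteq> 0\<^sub>v n" using v(1) by (metis index_vec index_zero_vec(1))
    moreover have "?v \<in> carrier_vec n" by simp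
    ultimately show ?l by blast
  qed
  ultimately show ?thesis using det_0_iff_vec_prod_zero_field[OF A] by simp
qed

lemma of_real_leibniz_det:
  "of_real (leibniz_det n a) = leibniz_det n (\<lambda>i j. of_real (a i j))"
  by (simp add: leibniz_det_def)

lemma polyfun_leibniz_det:
  assumes "\<And>i j. i < n \<Longrightarrow> j < n \<Longrightarrow> polyfun X (\<lambda>x. a x i j)"
  shows "polyfun X (\<lambda>x. leibniz_det n (a x))"
  unfolding leibniz_det_def
  by (intro polyfun_sum polyfun_mult polyfun_prod polyfun_const assms) (auto simp: permutes_in_image)

text \<open>Real parts make this a real matrix, so its real kernel vectors are coefficient vectors
  of elements of the real space \<open>L\<close>.\<close>

definition gram :: "(nat \<Rightarrow> 'a \<Rightarrow> complex) \<Rightarrow> 'a list \<Rightarrow> nat \<Rightarrow> nat \<Rightarrow> real" where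
  "gram b Z i j = (\<Sum>k<length Z. Re (b i (Z ! k) * cnj (b j (Z ! k))))"

text \<open>The quadratic form of the Gram matrix at \<open>v\<close> is the sum of the squared
  moduli of \<open>q v\<close> at the samples. Hence the kernel vectors are the coefficients of
  combinations vanishing at all samples, and independence turns nonzero coefficients into nonzero
  combinations.\<close>

lemma poised_iff_gram_det:
  fixes b :: "nat \<Rightarrow> complex ^ 'n \<Rightarrow> complex"
  assumes L: "L = range (\<lambda>v :: nat \<Rightarrow> real. \<Sum>i<n. v i *\<^sub>R b i)"
    and ind: "\<And>v :: nat \<Rightarrow> real. (\<Sum>i<n. v i *\<^sub>R b i) = 0 \<Longrightarrow> \<forall>i<n. v i = 0"
  shows "poised L (set Z) \<longleftrightarrow> leibniz_det n (gram b Z) \<noteq> 0"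
proof -
  define q where "q v = (\<Sum>i<n. v i *\<^sub>R b i)" for v :: "nat \<Rightarrow> real"
  have q: "q v z = (\<Sum>i<n. of_real (v i) * b i z)" for v z
    unfolding q_def by (induction n) (simp_all add: scaleR_fun_def scaleR_conv_of_real)
  have gram: "(\<Sum>j<n. gram b Z i j * v j) = (\<Sum>k<length Z. Re (b i (Z ! k) * cnj (q v (Z ! k))))" for v i
  proof -
    have "(\<Sum>j<n. gram b Z i j * v j) =
        (\<Sum>k<length Z. \<Sum>j<n. Re (b i (Z ! k) * cnj (b j (Z ! k))) * v j)"
      unfolding gram_def sum_distrib_right by (rule sum.swap)
    also have "\<dots> = (\<Sum>k<length Z. Re (\<Sum>j<n. b i (Z ! k) * cnj (of_real (v j) * b j (Z ! k))))"
      by (simp add: algebra_simps)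
    finally show ?thesis by (simp only: q sum_distrib_left cnj_sum)
  qed
  have energy: "(\<Sum>i<n. v i * (\<Sum>j<n. gram b Z i j * v j)) = (\<Sum>k<length Z. (cmod (q v (Z ! k)))\<^sup>2)" for v
  proof -
    have "(\<Sum>i<n. v i * (\<Sum>j<n. gram b Z i j * v j)) =
        (\<Sum>k<length Z. \<Sum>i<n. v i * Re (b i (Z ! k) * cnj (q v (Z ! k))))"
      unfolding gram sum_distrib_left by (rule sum.swap)
    also have "\<dots> = (\<Sum>k<length Z. Re (q v (Z ! k) * cnj (q v (Z ! k))))"
    proof (rule sum.cong[OF refl])
      fix k
      have "Re (q v (Z ! k) * cnj (q v (Z ! k))) =
          Re (\<Sum>i<n. of_real (v i) * (b i (Z ! k) * cnj (q v (Z ! k))))"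
        unfolding sum_distrib_left [symmetric] by (subst (1) q) (simp only: sum_distrib_right mult.assoc)
      then show "(\<Sum>i<n. v i * Re (b i (Z ! k) * cnj (q v (Z ! k)))) = Re (q v (Z ! k) * cnj (q v (Z ! k)))"
        by simp
    qed
    finally show ?thesis unfolding complex_norm_square[symmetric] Re_complex_of_real .
  qed
  have "(\<forall>i<n. (\<Sum>j<n. gram b Z i j * v j) = 0) \<longleftrightarrow> (\<forall>z\<in>set Z. q v z = 0)" for v
  proof
    assume "\<forall>i<n. (\<Sum>j<n. gram b Z i j * v j) = 0"
    then have "(\<Sum>k<length Z. (cmod (q v (Z ! k)))\<^sup>2) = 0"
      unfolding energy[symmetric] by simp
    then show "\<forall>z\<in>set Z. q v z = 0"
      by (simp add: sum_nonneg_eq_0_iff all_set_conv_all_nth)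
  qed (auto simp: gram)
  moreover have "q v = 0 \<longleftrightarrow> (\<forall>i<n. v i = 0)" for v
    using ind[of v] by (auto simp: q_def)
  ultimately show ?thesis
    unfolding leibniz_det_eq_0_iff poised_def L q_def[symmetric] ball_simps(9)
    by (simp only:) (meson UNIV_I)
qed

text \<open>Numbering a basis by the naturals below \<open>n\<close> supplies the row and column
  indices of the determinant.\<close>

lemma finite_dim_subspace_basis:
  fixes L :: "'a::real_vector set"
  assumes "subspace L" "finite B" "L \<subseteq> span B"
  obtains n and b :: "nat \<Rightarrow> 'a" where "L = range (\<lambda>v :: nat \<Rightarrow> real. \<Sum>i<n. v i *\<^sub>R b i)"
    and "\<And>v :: nat \<Rightarrow> real. (\<Sum>i<n. v i *\<^sub>R b i) = 0 \<Longrightarrow> \<forall>i<n. v i = 0"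
proof -
  obtain E where E: "E \<subseteq> L" "independent E" "L \<subseteq> span E"
    using basis_exists by metis
  have fin: "finite E" using independent_span_bound[OF assms(2) E(2)] E(1) assms(3) by blast
  obtain b where b: "bij_betw b {..<card E} E"
    using ex_bij_betw_nat_finite[OF fin] by (auto simp: atLeast0LessThan)
  define b' where "b' = the_inv_into {..<card E} b"
  have b': "b' (b i) = i" if "i < card E" for i
    using that b by (simp add: b'_def the_inv_into_f_f bij_betw_def)
  have reindex: "(\<Sum>i<card E. v i *\<^sub>R b i) = (\<Sum>e\<in>E. v (b' e) *\<^sub>R e)" for v :: "nat \<Rightarrow> real"
    unfolding sum.reindex_bij_betw[OF b, symmetric] by (intro sum.cong) (auto simp: b')
  have reindex': "(\<Sum>e\<in>E. u e *\<^sub>R e) = (\<Sum>i<card E. u (b i) *\<^sub>R b i)" for u :: "'a \<Rightarrow> real"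
    unfolding sum.reindex_bij_betw[OF b, symmetric] ..
  have "L = span E" using E assms(1) by (metis span_minimal subset_antisym)
  also have "\<dots> = range (\<lambda>v :: nat \<Rightarrow> real. \<Sum>i<card E. v i *\<^sub>R b i)"
    unfolding span_finite[OF fin]
  proof (intro equalityI image_subsetI)
    show "(\<Sum>e\<in>E. u e *\<^sub>R e) \<in> range (\<lambda>v. \<Sum>i<card E. v i *\<^sub>R b i)" for u
      by (rule range_eqI[of _ _ "\<lambda>i. u (b i)"]) (rule reindex')
    show "(\<Sum>i<card E. v i *\<^sub>R b i) \<in> range (\<lambda>u. \<Sum>e\<in>E. u e *\<^sub>R e)" for v :: "nat \<Rightarrow> real"
      by (rule range_eqI[of _ _ "\<lambda>e. v (b' e)"]) (rule reindex)
  qed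
  finally have "L = range (\<lambda>v :: nat \<Rightarrow> real. \<Sum>i<card E. v i *\<^sub>R b i)" .
  moreover have "\<forall>i<card E. v i = 0" if "(\<Sum>i<card E. v i *\<^sub>R b i) = 0" for v :: "nat \<Rightarrow> real"
  proof (intro allI impI)
    fix i assume i: "i < card E"
    then have "b i \<in> E" using b by (auto simp: bij_betw_def)
    then have "v (b' (b i)) = 0"
      using E(2) that fin unfolding reindex by (auto simp: dependent_finite)
    then show "v i = 0" using b' i by simp
  qed
  ultimately show ?thesis using that by blast
qed

section \<open>The Gram determinant as a witness of c-genericity\<close>

theorem theorem5:
  fixes W V :: "(complex ^ 'n) set"
    and L :: "(complex ^ 'n \<Rightarrow> complex) set"
    and S :: nat
  assumes "irreducible_variety W"
    and "V = W \<union> vec_cnj ` W"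
    and "L \<subseteq> real_coord_ring V"
    and "subspace L"
    and "\<exists>B. finite B \<and> span B = L"
    and "real S \<ge> real (dim L) / 2"
  shows "c_generically W S (\<lambda>Z. poised L (set Z))"
proof -
  obtain B where B: "finite B" "L \<subseteq> span B" using assms(5) by auto
  obtain n b where L: "L = range (\<lambda>v :: nat \<Rightarrow> real. \<Sum>i<n. v i *\<^sub>R b i)"
    and ind: "\<And>v :: nat \<Rightarrow> real. (\<Sum>i<n. v i *\<^sub>R b i) = 0 \<Longrightarrow> \<forall>i<n. v i = 0"
    using finite_dim_subspace_basis[OF assms(4) B] by blast
  have "b i \<in> L" if "i < n" for i
  proof -
    have "b i = (\<Sum>j<n. (if j = i then 1 else 0) *\<^sub>R b j)"
      using that by (simp add: if_distrib[of "\<lambda>r. r *\<^sub>R _"] cong: if_cong)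
    then show ?thesis unfolding L by (rule range_eqI[of _ _ "\<lambda>j. if j = i then 1 else 0"])
  qed
  then have "\<forall>i. \<exists>p. i < n \<longrightarrow> b i = coord_fun V p"
    using assms(3) by (auto simp: real_coord_ring_def)
  then obtain p where p: "\<And>i. i < n \<Longrightarrow> b i = coord_fun V (p i)" by metis
  define X :: "((nat \<times> 'n) + (nat \<times> 'n)) set" where "X = ({..<S} \<times> UNIV) <+> ({..<S} \<times> UNIV)"
  \<comment> \<open>At the coordinates of a tuple, \<open>l\<close> is the value of
    \<open>b i\<close> at a sample and \<open>r\<close> is its conjugate, because \<open>p i\<close>
    has real coefficients.\<close>
  define l where "l x k i = insertion (\<lambda>j. x (Inl (k, j))) (complexify (p i))"
    for x :: "(nat \<times> 'n) + (nat \<times> 'n) \<Rightarrow> complex" and k i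
  define r where "r x k i = insertion (\<lambda>j. x (Inr (k, j))) (complexify (p i))"
    for x :: "(nat \<times> 'n) + (nat \<times> 'n) \<Rightarrow> complex" and k i
  \<comment> \<open>Writing \<open>Re u\<close> as \<open>(u + cnj u) / 2\<close> makes the Gram
    entries polynomial in the samples and their conjugates.\<close>
  define a where "a x i j = (\<Sum>k<S. (l x k i * r x k j + r x k i * l x k j) * (1 / 2))"
    for x i j
  have "polyfun X (\<lambda>x. leibniz_det n (a x))"
    unfolding a_def l_def r_def X_def
    by (intro polyfun_leibniz_det polyfun_sum polyfun_mult polyfun_add polyfun_const polyfun_insertion)
      auto
  then obtain Q where Q: "vars Q \<subseteq> X" "\<And>x. insertion x Q = leibniz_det n (a x)"
    by (auto simp: polyfun_def)
  have eq: "insertion (sample_coords Z) Q = of_real (leibniz_det n (gram b Z))" if Z: "Z \<in> tuples S W" for Z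
  proof -
    have "a (sample_coords Z) i j = of_real (gram b Z i j)" if ij: "i < n" "j < n" for i j
    proof -
      have lr: "l (sample_coords Z) k i = b i (Z ! k)" "r (sample_coords Z) k i = cnj (b i (Z ! k))"
        if "k < S" "i < n" for k i
      proof -
        have "Z ! k \<in> V" using Z that assms(2) by (auto simp: tuples_def)
        moreover have "(\<lambda>j. cnj (Z ! k $ j)) = (\<lambda>j. vec_cnj (Z ! k) $ j)" by (simp add: vec_cnj_def)
        ultimately show "l (sample_coords Z) k i = b i (Z ! k)" "r (sample_coords Z) k i = cnj (b i (Z ! k))"
          using that(2)
          by (simp_all add: l_def r_def p coord_fun_def sample_coords_def flip: insertion_complexify_cnj)
      qed
      have summand: "(l (sample_coords Z) k i * r (sample_coords Z) k j + r (sample_coords Z) k i * l (sample_coords Z) k j)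
          * (1 / 2) = of_real (Re (b i (Z ! k) * cnj (b j (Z ! k))))" if "k < S" for k
        using complex_add_cnj[of "b i (Z ! k) * cnj (b j (Z ! k))"] that ij by (simp add: lr)
      then show ?thesis
        using Z unfolding a_def gram_def of_real_sum by (intro sum.cong summand) (auto simp: tuples_def)
    qed
    then have "leibniz_det n (a (sample_coords Z)) = leibniz_det n (\<lambda>i j. of_real (gram b Z i j))"
      unfolding leibniz_det_def by (intro sum.cong refl arg_cong2[of _ _ _ _ "(*)"] prod.cong)
        (auto simp: permutes_in_image)
    then show ?thesis by (simp add: Q(2) of_real_leibniz_det)
  qed
  have iff: "poised L (set Z) \<longleftrightarrow> insertion (sample_coords Z) Q \<noteq> 0" if "Z \<in> tuples S W" for Z
    using poised_iff_gram_det[OF L ind] eq[OF that] by simp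
  \<comment> \<open>By \<open>iff\<close>, one poised tuple is enough to show that \<open>Q\<close>
    does not vanish identically on the tuples.\<close>
  have "dim L \<le> 2 * S" using assms(6) by linarith
  then have "\<exists>Z\<in>tuples S W. poised L (set Z)"
    by (rule exists_poised_tuple[OF assms(1,2) B(1) assms(3,4) B(2)])
  then show ?thesis
    unfolding c_generically_def using Q(1) iff by (intro exI[of _ Q]) (auto simp: X_def)
qed

end
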